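(* Let $\mathcal{V}=\{1,\dots,n_y\}$ be the finite set of available sensing nodes, and for $\mathcal{S}\subseteq\mathcal{V}$ let $V_o(\mathcal{S})\in\mathbb{R}^{n_x\times n_x}$ be the parameterized variational observability Gramian, around an initial state $x_0\in\mathcal{X}_0$ and over the observation horizon $\mathrm{N}\ge 1$, of the discrete-time nonlinear system $x_{k+1}=x_k+\tilde f(x_k)$, $y_k=\tilde C x_k$. Then the set function $f:2^{\mathcal{V}}\to\mathbb{R}$ defined by $$f(\mathcal{S})=\operatorname{rank}\left(V_o(\mathcal{S})\right),\qquad \mathcal{S}\subseteq\mathcal{V},$$ is submodular and monotone increasing.
   Context: System. $\mathcal{M}\subseteq\mathbb{R}^{n_x}$ is the (open) state space, and $\tilde f:\mathcal{M}\to\mathbb{R}^{n_x}$ is smooth (at least twice continuously differentiable). The system is $x_{k+1}=x_k+\tilde f(x_k)$, $y_k=\tilde C x_k$, $k=0,1,2,\dots$, with $x_k\in\mathbb{R}^{n_x}$, $y_k\in\mathbb{R}^{n_y}$. Standing assumption: there is a compact set $\mathcal{X}\subseteq\mathcal{M}$ such that the trajectory remains in $\mathcal{X}$ for every initial state $x_0\in\mathcal{X}_0$ and every $k\ge 0$, where $\mathcal{X}_0\subseteq\mathcal{X}$ is the set of initial states. Sensor parameterization. Sensor $j\in\mathcal{V}$ has a measurement row $c_j\in\mathbb{R}^{1\times n_x}$. For $\mathcal{S}\subseteq\mathcal{V}$, $\tilde C=\tilde C(\mathcal{S})\in\mathbb{R}^{n_y\times n_x}$ is the matrix whose $j$-th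 row is $c_j$ if $j\in\mathcal{S}$ (sensor selected) and $0$ otherwise. Variational mapping. For the trajectory from $x_0$, $\Phi_0^k\in\mathbb{R}^{n_x\times n_x}$ is the Jacobian $\partial x_k/\partial x_0$; thus $\Phi_0^0=I_{n_x}$ and, by the chain rule, $\Phi_0^k=\Phi_{k-1}^k\Phi_{k-2}^{k-1}\cdots\Phi_0^1$ with $\Phi_{i-1}^{i}=I_{n_x}+\frac{\partial\tilde f}{\partial x}(x_{i-1})$. Gramian. $\Psi_0^k:=\tilde C(\mathcal{S})\Phi_0^k$, and $\Psi\in\mathbb{R}^{\mathrm{N}n_y\times n_x}$ is the vertical stacking of $\Psi_0^0,\Psi_0^1,\dots,\Psi_0^{\mathrm{N}-1}$. The variational observability Gramian is $V_o(\mathcal{S}):=\Psi^\top\Psi=\sum_{k=0}^{\mathrm{N}-1}(\Phi_0^k)^\top\tilde C(\mathcal{S})^\top\tilde C(\mathcal{S})\Phi_0^k$. Set functions. $f:2^{\mathcal{V}}\to\mathbb{R}$ is submodular if for all $\mathcal{A}\subseteq\mathcal{B}\subseteq\mathcal{V}$ and all $s\in\mathcal{V}\setminus\mathcal{B}$, $f(\mathcal{A}\cup\{s\})-f(\mathcal{A})\ge f(\mathcal{B}\cup\{s\})-f(\mathcal{B})$. It is monotone increasing if $\mathcal{A}\subseteq\mathcal{B}\subseteq\mathcal{V}$ implies $f(\mathcal{B})\ge f(\mathcal{A})$. *)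

theory Defs
  imports "HOL-Analysis.Analysis"
begin

definition submodular_on :: "'a set \<Rightarrow> ('a set \<Rightarrow> real) \<Rightarrow> bool" where
  "submodular_on V f \<longleftrightarrow>
     (\<forall>A B. A \<subseteq> B \<and> B \<subseteq> V \<longrightarrow>
       (\<forall>s \<in> V - B. f (A \<union> {s}) - f A \<ge> f (B \<union> {s}) - f B))"

definition twice_continuously_differentiable_on ::
  "('a::real_normed_vector \<Rightarrow> 'b::real_normed_vector) \<Rightarrow> 'a set \<Rightarrow> bool" where
  "twice_continuously_differentiable_on f M \<longleftrightarrow>
     (\<exists>(f' :: 'a \<Rightarrow> 'a \<Rightarrow>\<^sub>L 'b) (f'' :: 'a \<Rightarrow> 'a \<Rightarrow>\<^sub>L ('a \<Rightarrow>\<^sub>L 'b)).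
        (\<forall>x\<in>M. (f has_derivative blinfun_apply (f' x)) (at x)) \<and>
        (\<forall>x\<in>M. (f' has_derivative blinfun_apply (f'' x)) (at x)) \<and>
        continuous_on M f'')"

primrec trajectory :: "('a::plus \<Rightarrow> 'a) \<Rightarrow> nat \<Rightarrow> 'a \<Rightarrow> 'a" where
  "trajectory f 0 x = x"
| "trajectory f (Suc k) x = trajectory f k x + f (trajectory f k x)"

text \<open>
  \<open>f\<close> is total, but values outside an open state space \<open>M\<close> with \<open>f\<close> continuous on \<open>M\<close> are harmless:
  if the trajectory from \<open>x0\<close> stays in \<open>M\<close>, then up to any fixed time so do the trajectories
  from a neighbourhood of \<open>x0\<close>, and these determine the Jacobian.
\<close>

definition variational_map :: "(real^'n \<Rightarrow> real^'n) \<Rightarrow> nat \<Rightarrow> real^'n \<Rightarrow> real^'n^'n" where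
  "variational_map f k x0 = jacobian (trajectory f k) (at x0)"

text \<open>The sensing nodes are the elements of the index type \<open>'m\<close>; \<open>c j\<close> is the row of sensor \<open>j\<close>.\<close>

definition output_matrix :: "('m \<Rightarrow> real^'n) \<Rightarrow> 'm set \<Rightarrow> real^'n^'m" where
  "output_matrix c S = (\<chi> j. if j \<in> S then c j else 0)"

definition output_variation ::
  "(real^'n \<Rightarrow> real^'n) \<Rightarrow> ('m \<Rightarrow> real^'n) \<Rightarrow> 'm set \<Rightarrow> nat \<Rightarrow> real^'n \<Rightarrow> real^'n^'m" where
  "output_variation f c S k x0 = output_matrix c S ** variational_map f k x0"

text \<open>
  \<open>\<Psi>\<^sup>T \<Psi>\<close> for the vertical stacking \<open>\<Psi>\<close> of the output variations at times \<open>0, \<dots>, N - 1\<close>;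
  it is written as a sum because the number of rows of \<open>\<Psi>\<close> depends on \<open>N\<close>, which is not a type.
\<close>

definition observability_gramian ::
  "(real^'n \<Rightarrow> real^'n) \<Rightarrow> ('m::finite \<Rightarrow> real^'n) \<Rightarrow> nat \<Rightarrow> real^'n \<Rightarrow> 'm set \<Rightarrow> real^'n^'n" where
  "observability_gramian f c N x0 S =
     (\<Sum>k<N. transpose (output_variation f c S k x0) ** output_variation f c S k x0)"

lemma observability_gramian_stacked:
  "observability_gramian f c N x0 S $ i $ l =
     (\<Sum>(k, j)\<in>{..<N} \<times> UNIV.
        output_variation f c S k x0 $ j $ i * output_variation f c S k x0 $ j $ l)"
  by (simp add: observability_gramian_def matrix_matrix_mult_def transpose_def
      sum.cartesian_product)

lemma trajectory_differentiable:
  fixes f :: "real^'n \<Rightarrow> real^'n"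
  assumes "\<And>i. i < k \<Longrightarrow> f differentiable (at (trajectory f i x0))"
  shows "trajectory f k differentiable (at x0)"
  using assms
proof (induction k)
  case 0
  have "trajectory f 0 = (\<lambda>x. x)" by (rule ext) simp
  then show ?case by simp
next
  case (Suc k)
  have d: "trajectory f k differentiable (at x0)" using Suc by simp
  have "(\<lambda>x. f (trajectory f k x)) differentiable (at x0)"
    using differentiable_chain_at[OF d] Suc.prems[of k] by (simp add: o_def)
  with d have "(\<lambda>x. trajectory f k x + f (trajectory f k x)) differentiable (at x0)"
    by (rule differentiable_add)
  moreover have "trajectory f (Suc k) = (\<lambda>x. trajectory f k x + f (trajectory f k x))"
    by (rule ext) simp
  ultimately show ?case by simp
qed

lemma variational_map_0: "variational_map f 0 x0 = mat 1"
proof -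
  have "trajectory f 0 = (\<lambda>x. x)" by (rule ext) simp
  then show ?thesis
    by (simp add: variational_map_def jacobian_def frechet_derivative_ident matrix_id_mat_1 flip: id_def)
qed

lemma variational_map_Suc:
  fixes f :: "real^'n \<Rightarrow> real^'n"
  assumes "\<And>i. i \<le> k \<Longrightarrow> f differentiable (at (trajectory f i x0))"
  shows "variational_map f (Suc k) x0 =
    (mat 1 + jacobian f (at (trajectory f k x0))) ** variational_map f k x0"
proof -
  let ?A = "jacobian f (at (trajectory f k x0))"
  let ?P = "variational_map f k x0"
  have "trajectory f k differentiable (at x0)"
    by (rule trajectory_differentiable) (use assms in simp)
  then have t: "(trajectory f k has_derivative (\<lambda>v. ?P *v v)) (at x0)"
    unfolding variational_map_def jacobian_works .
  have a: "(f has_derivative (\<lambda>v. ?A *v v)) (at (trajectory f k x0))"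
    using assms[of k] jacobian_works by auto
  have "((\<lambda>x. trajectory f k x + f (trajectory f k x)) has_derivative
      (\<lambda>v. ?P *v v + ?A *v (?P *v v))) (at x0)"
    by (rule has_derivative_add[OF t has_derivative_compose[OF t a]])
  moreover have "(\<lambda>v. ?P *v v + ?A *v (?P *v v)) = (\<lambda>v. ((mat 1 + ?A) ** ?P) *v v)"
    by (rule ext) (simp add: matrix_vector_mul_assoc[symmetric] matrix_vector_mult_add_rdistrib)
  moreover have "trajectory f (Suc k) = (\<lambda>x. trajectory f k x + f (trajectory f k x))"
    by (rule ext) simp
  ultimately have "(trajectory f (Suc k) has_derivative
      (\<lambda>v. ((mat 1 + ?A) ** ?P) *v v)) (at x0)"
    by simp
  from frechet_derivative_at[OF this, symmetric] show ?thesis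
    by (simp add: variational_map_def[of f "Suc k"] jacobian_def[of "trajectory f (Suc k)"]
        matrix_of_matrix_vector_mul del: trajectory.simps)
qed

end

theory Submission
  imports Defs
begin

text \<open>
  The kernel of the Gramian is the set of vectors orthogonal to all rows
  \<open>c j v* \<Phi>\<^sub>0\<^sup>k\<close> of the selected sensors, because the associated quadratic form is a sum of squares.
  Hence the rank is the dimension of the span of these rows, that is, a coverage function of the
  sensor set composed with \<open>dim\<close>, and the submodularity of \<open>dim\<close> comes from the dimension formula
  for sums and intersections of subspaces.
\<close>

text \<open>The span of \<open>S \<union> T\<close> is the sum of the two spans, to which the
  dimension formula applies. Only an inequality remains, since \<open>S \<inter> T\<close> may span
  less than the intersection of the spans.\<close>

lemma dim_Un_Int_le:
  fixes S T :: "'a::euclidean_space set"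
  shows "dim (S \<union> T) + dim (S \<inter> T) \<le> dim S + dim T"
proof -
  have "dim (S \<inter> T) \<le> dim (span S \<inter> span T)"
    by (rule dim_subset[OF Int_mono[OF span_superset span_superset]])
  moreover have "dim (S \<union> T) = dim {x + y |x y. x \<in> span S \<and> y \<in> span T}"
    by (simp only: span_Un flip: dim_span[of "S \<union> T"])
  ultimately show ?thesis
    using dim_sums_Int[of "span S" "span T"] by simp
qed

lemma submodular_on_dim_UN:
  fixes R :: "'a \<Rightarrow> 'b::euclidean_space set"
  shows "submodular_on V (\<lambda>S. real (dim (\<Union>j\<in>S. R j)))"
  unfolding submodular_on_def
proof (intro allI impI ballI)
  fix A B s
  assume sub: "A \<subseteq> B \<and> B \<subseteq> V"
  let ?U = "\<lambda>S. \<Union>j\<in>S. R j"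
  \<comment> \<open>\<open>dim_Un_Int_le\<close> is used for \<open>?U B\<close> and
    \<open>?U (A \<union> {s})\<close>. Their intersection contains \<open>?U A\<close> but may be
    larger, as \<open>R s\<close> can meet \<open>?U B\<close> outside \<open>?U A\<close>.\<close>
  have "?U B \<union> ?U (A \<union> {s}) = ?U (B \<union> {s})"
    using sub by auto
  then have "dim (?U (B \<union> {s})) + dim (?U B \<inter> ?U (A \<union> {s})) \<le> dim (?U B) + dim (?U (A \<union> {s}))"
    by (metis dim_Un_Int_le)
  moreover have "dim (?U A) \<le> dim (?U B \<inter> ?U (A \<union> {s}))"
    by (rule dim_subset) (use sub in auto)
  ultimately have "dim (?U (B \<union> {s})) + dim (?U A) \<le> dim (?U B) + dim (?U (A \<union> {s}))"
    by (meson add_left_mono order_trans)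
  then have "real (dim (?U (B \<union> {s}))) + real (dim (?U A))
      \<le> real (dim (?U B)) + real (dim (?U (A \<union> {s})))"
    by (simp only: of_nat_le_iff flip: of_nat_add)
  then show "real (dim (?U (A \<union> {s}))) - real (dim (?U A))
      \<ge> real (dim (?U (B \<union> {s}))) - real (dim (?U B))"
    by argo
qed

lemma mono_on_dim_UN:
  fixes R :: "'a \<Rightarrow> 'b::euclidean_space set"
  shows "mono_on X (\<lambda>S. real (dim (\<Union>j\<in>S. R j)))"
proof (rule mono_onI)
  fix A B :: "'a set"
  assume "A \<subseteq> B"
  then have "(\<Union>j\<in>A. R j) \<subseteq> (\<Union>j\<in>B. R j)"
    by blast
  then show "real (dim (\<Union>j\<in>A. R j)) \<le> real (dim (\<Union>j\<in>B. R j))"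
    using dim_subset by simp
qed

text \<open>The vectors orthogonal to a fixed \<open>x\<close> form a subspace, so orthogonality
  passes from \<open>S\<close> to its span.\<close>

lemma orthogonal_comp_span: "(span S)\<^sup>\<bottom> = S\<^sup>\<bottom>"
proof
  show "(span S)\<^sup>\<bottom> \<subseteq> S\<^sup>\<bottom>"
    by (rule orthogonal_comp_anti_mono[OF span_superset])
  show "S\<^sup>\<bottom> \<subseteq> (span S)\<^sup>\<bottom>"
  proof
    fix x assume "x \<in> S\<^sup>\<bottom>"
    then have "orthogonal x y" if "y \<in> span S" for y
      using that by (auto simp: orthogonal_comp_def orthogonal_commute intro: orthogonal_to_span)
    then show "x \<in> (span S)\<^sup>\<bottom>"
      by (auto simp: orthogonal_comp_def orthogonal_commute)
  qed
qed

text \<open>In finite dimension a subspace equals its double orthogonal complement, so the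
  complement of a set determines its span.\<close>

lemma dim_eq_if_orthogonal_comp_eq:
  fixes S T :: "'a::euclidean_space set"
  assumes "S\<^sup>\<bottom> = T\<^sup>\<bottom>"
  shows "dim S = dim T"
proof -
  have "span S = span T"
    using assms by (metis orthogonal_comp_self orthogonal_comp_span subspace_span)
  then show ?thesis
    by (metis dim_span)
qed

text \<open>Links kernels to row rank: the components of \<open>A *v v\<close> are the inner
  products of the rows of \<open>A\<close> with \<open>v\<close>.\<close>

lemma orthogonal_comp_rows:
  fixes A :: "real^'n^'m"
  shows "(rows A)\<^sup>\<bottom> = {v. A *v v = 0}"
proof -
  have "row i A = A $ i" for i
    by (simp add: row_def)
  then show ?thesis
    by (auto simp: orthogonal_comp_def orthogonal_def rows_def vec_eq_iff[of _ "0::real^'m"]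
        matrix_vector_mul_component)
qed

lemma sum_Gram_mult_eq_0_iff:
  fixes A :: "'a \<Rightarrow> real^'n^'m"
  assumes "finite K"
  shows "(\<Sum>k\<in>K. transpose (A k) ** A k) *v v = 0 \<longleftrightarrow> (\<forall>k\<in>K. A k *v v = 0)"
proof -
  have mult: "(\<Sum>k\<in>K. transpose (A k) ** A k) *v v = (\<Sum>k\<in>K. transpose (A k) *v (A k *v v))"
    using assms
    by (induction K) (simp_all add: matrix_vector_mult_add_rdistrib matrix_vector_mul_assoc)
  \<comment> \<open>Pairing with \<open>v\<close> moves each transpose across the inner product,
    leaving nonnegative terms whose sum vanishes only termwise.\<close>
  have "v \<bullet> (transpose (A k) *v (A k *v v)) = (A k *v v) \<bullet> (A k *v v)" for k
    by (metis dot_lmul_matrix vector_transpose_matrix)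
  then have "v \<bullet> ((\<Sum>k\<in>K. transpose (A k) ** A k) *v v) = (\<Sum>k\<in>K. (A k *v v) \<bullet> (A k *v v))"
    by (simp add: mult inner_sum_right)
  moreover have "(\<Sum>k\<in>K. (A k *v v) \<bullet> (A k *v v)) = 0 \<longleftrightarrow> (\<forall>k\<in>K. A k *v v = 0)"
    using assms by (subst sum_nonneg_eq_0_iff) auto
  ultimately show ?thesis
    by (auto simp: mult)
qed

text \<open>An unselected sensor has a zero row and so imposes no condition on
  \<open>v\<close>.\<close>

lemma output_variation_mult_eq_0_iff:
  "output_variation f c S k x0 *v v = 0 \<longleftrightarrow> (\<forall>j\<in>S. (c j v* variational_map f k x0) \<bullet> v = 0)"
proof -
  let ?P = "variational_map f k x0"
  have "output_variation f c S k x0 *v v = output_matrix c S *v (?P *v v)"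
    by (simp add: output_variation_def matrix_vector_mul_assoc)
  moreover have "(output_matrix c S *v w) $ j = (if j \<in> S then c j \<bullet> w else 0)" for w j
    by (simp add: output_matrix_def matrix_vector_mul_component)
  ultimately show ?thesis
    unfolding vec_eq_iff[of _ 0] dot_lmul_matrix by auto
qed

text \<open>The rows are grouped by sensor rather than by time: the set attached to \<open>j\<close>
  does not depend on \<open>S\<close>, which is the form required by
  \<open>submodular_on_dim_UN\<close> and \<open>mono_on_dim_UN\<close>.\<close>

lemma rank_observability_gramian:
  "rank (observability_gramian f c N x0 S) =
    dim (\<Union>j\<in>S. (\<lambda>k. c j v* variational_map f k x0) ` {..<N})"
  unfolding row_rank_def
proof (rule dim_eq_if_orthogonal_comp_eq)
  show "(rows (observability_gramian f c N x0 S))\<^sup>\<bottom> =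
      (\<Union>j\<in>S. (\<lambda>k. c j v* variational_map f k x0) ` {..<N})\<^sup>\<bottom>"
    unfolding orthogonal_comp_rows observability_gramian_def
    by (auto simp: sum_Gram_mult_eq_0_iff output_variation_mult_eq_0_iff
        orthogonal_comp_def orthogonal_def)
qed

theorem corollary2:
  fixes M X X0 :: "(real^'n) set"
    and ftilde :: "real^'n \<Rightarrow> real^'n"
    and c :: "'m::finite \<Rightarrow> real^'n"
    and N :: nat
    and x0 :: "real^'n"
  assumes "open M"
    and "twice_continuously_differentiable_on ftilde M"
    and "compact X" and "X \<subseteq> M" and "X0 \<subseteq> X"
    and "\<And>x k. x \<in> X0 \<Longrightarrow> trajectory ftilde k x \<in> X"
    and "x0 \<in> X0"
    and "N \<ge> 1"
  shows "submodular_on UNIV (\<lambda>S. real (rank (observability_gramian ftilde c N x0 S)))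
      \<and> mono_on (Pow UNIV) (\<lambda>S. real (rank (observability_gramian ftilde c N x0 S)))"
  unfolding rank_observability_gramian by (rule conjI[OF submodular_on_dim_UN mono_on_dim_UN])

end
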